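(* Let $\lambda$ be a nonzero real number. For all $n\in\mathbb{N}$ and all integers $r\ge1$, $$n!\,H_{n,\lambda}^{(r)}={n+r \brack r+1}_{r,\lambda},$$ and for all $n\in\mathbb{N}$, $$n!\,H_{n,\lambda}=2!\,\lambda{n+1 \brack 3}_{1,\lambda}+{n+1 \brack 2}_{\lambda},$$ where ${n+1 \brack 2}_{\lambda}=(-1)^{n-1}S_{1,\lambda}(n+1,2)$ are unsigned degenerate Stirling numbers of the first kind.
   Context: $\mathbb{N}=\{1,2,3,\dots\}$. Factorials: $(y)_0=1$, $(y)_n=y(y-1)\cdots(y-n+1)$; $(y)_{0,\lambda}=1$, $(y)_{n,\lambda}=y(y-\lambda)\cdots(y-(n-1)\lambda)$; $\langle y\rangle_0=1$, $\langle y\rangle_n=y(y+1)\cdots(y+n-1)$; $\langle y\rangle_{0,\lambda}=1$, $\langle y\rangle_{n,\lambda}=y(y+\lambda)\cdots(y+(n-1)\lambda)$ ($n\ge1$). Degenerate harmonic numbers: $H_{0,\lambda}=0$, $H_{n,\lambda}=\sum_{k=1}^{n}\frac{1}{\lambda}\binom{\lambda}{k}(-1)^{k-1}$ for $n\ge1$, where $\binom{\lambda}{k}=\lambda(\lambda-1)\cdots(\lambda-k+1)/k!$. Degenerate hyperharmonic numbers: $H_{n,\lambda}^{(1)}=H_{n,\lambda}$; $H_{0,\lambda}^{(r)}=0$ for $r\ge1$; $H_{n,\lambda}^{(r)}=\sum_{k=1}^{n}H_{k,\lambda}^{(r-1)}$ for $r\ge2$, $n\ge1$. Degenerate Stirling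 numbers of the first kind $S_{1,\lambda}(n,k)$: defined by the polynomial identity $(y)_n=\sum_{k=0}^{n}S_{1,\lambda}(n,k)(y)_{k,\lambda}$; the unsigned ones are ${n \brack k}_\lambda=(-1)^{n-k}S_{1,\lambda}(n,k)$. Degenerate unsigned $r$-Stirling numbers of the first kind ($r\ge0$): defined by the polynomial identity $\langle y+r\rangle_n=\sum_{k=0}^{n}{n+r \brack k+r}_{r,\lambda}\langle y\rangle_{k,\lambda}$, with ${n+r \brack k+r}_{r,\lambda}=0$ for $k>n$. *)

theory Defs
  imports Complex_Main
begin

definition falling_fact :: "real \<Rightarrow> nat \<Rightarrow> real" where
  "falling_fact y n = (\<Prod>i<n. y - real i)"

definition deg_falling_fact :: "real \<Rightarrow> real \<Rightarrow> nat \<Rightarrow> real" where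
  "deg_falling_fact lam y n = (\<Prod>i<n. y - real i * lam)"

text \<open>The rising factorial with step 1 is the library's \<^const>\<open>pochhammer\<close>.\<close>

definition deg_rising_fact :: "real \<Rightarrow> real \<Rightarrow> nat \<Rightarrow> real" where
  "deg_rising_fact lam y n = (\<Prod>i<n. y + real i * lam)"

definition deg_harmonic :: "real \<Rightarrow> nat \<Rightarrow> real" where
  "deg_harmonic lam n = (\<Sum>k=1..n. 1 / lam * (lam gchoose k) * (-1) ^ (k - 1))"

text \<open>The second argument is the order \<open>r\<close>. Only orders \<open>r \<ge> 1\<close> are meaningful;
  the value at \<open>r = 0\<close> is a dummy on which no other order depends.\<close>

fun deg_hyperharmonic :: "real \<Rightarrow> nat \<Rightarrow> nat \<Rightarrow> real" where
  "deg_hyperharmonic lam 0 n = 0"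
| "deg_hyperharmonic lam (Suc 0) n = deg_harmonic lam n"
| "deg_hyperharmonic lam (Suc (Suc r)) n = (\<Sum>k=1..n. deg_hyperharmonic lam (Suc r) k)"

text \<open>Polynomial identities over the reals are stated as identities of polynomial functions.
  Both families of Stirling numbers below are the unique arrays satisfying such an identity;
  entries outside the range of the identity are zero. Existence and uniqueness, which
  justify the definite descriptions, are proved at the end for \<open>lam \<noteq> 0\<close>.\<close>

definition is_deg_stirling1 :: "real \<Rightarrow> (nat \<Rightarrow> nat \<Rightarrow> real) \<Rightarrow> bool" where
  "is_deg_stirling1 lam S \<longleftrightarrow>
     (\<forall>n y. falling_fact y n = (\<Sum>k=0..n. S n k * deg_falling_fact lam y k)) \<and>
     (\<forall>n k. k > n \<longrightarrow> S n k = 0)"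

definition deg_stirling1 :: "real \<Rightarrow> nat \<Rightarrow> nat \<Rightarrow> real" where
  "deg_stirling1 lam = (THE S. is_deg_stirling1 lam S)"

definition unsigned_deg_stirling1 :: "real \<Rightarrow> nat \<Rightarrow> nat \<Rightarrow> real" where
  "unsigned_deg_stirling1 lam n k = (-1) ^ (n - k) * deg_stirling1 lam n k"

text \<open>The arrays are indexed by the displayed (shifted) entries \<open>n + r\<close> and \<open>k + r\<close>;
  the last conjunct fixes the entries that are not of this form.\<close>

definition is_unsigned_deg_r_stirling1 ::
    "nat \<Rightarrow> real \<Rightarrow> (nat \<Rightarrow> nat \<Rightarrow> real) \<Rightarrow> bool" where
  "is_unsigned_deg_r_stirling1 r lam S \<longleftrightarrow>
     (\<forall>n y. pochhammer (y + real r) n =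
        (\<Sum>k=0..n. S (n + r) (k + r) * deg_rising_fact lam y k)) \<and>
     (\<forall>n k. k > n \<longrightarrow> S (n + r) (k + r) = 0) \<and>
     (\<forall>m j. m < r \<or> j < r \<longrightarrow> S m j = 0)"

definition unsigned_deg_r_stirling1 :: "nat \<Rightarrow> real \<Rightarrow> nat \<Rightarrow> nat \<Rightarrow> real" where
  "unsigned_deg_r_stirling1 r lam = (THE S. is_unsigned_deg_r_stirling1 r lam S)"

lemma deg_falling_fact_independent:
  assumes "lam \<noteq> 0" and eq: "\<And>y. (\<Sum>k=0..n. a k * deg_falling_fact lam y k) =
                                  (\<Sum>k=0..n. b k * deg_falling_fact lam y k)"
    and "j \<le> n"
  shows "a j = b j"
  using \<open>j \<le> n\<close>
proof (induction j rule: less_induct)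
  case (less j)
  let ?y = "real j * lam"
  have z: "deg_falling_fact lam ?y k = 0" if "k > j" for k
    unfolding deg_falling_fact_def using that by (intro prod_zero) auto
  have nz: "deg_falling_fact lam ?y j \<noteq> 0"
    unfolding deg_falling_fact_def using \<open>lam \<noteq> 0\<close> by (auto simp: prod_zero_iff)
  have "0 = (\<Sum>k=0..n. (a k - b k) * deg_falling_fact lam ?y k)"
    using eq[of ?y] by (simp add: left_diff_distrib sum_subtractf)
  also have "\<dots> = (\<Sum>k=0..n. if k = j then (a j - b j) * deg_falling_fact lam ?y j else 0)"
  proof (intro sum.cong refl)
    fix k assume "k \<in> {0..n}"
    then show "(a k - b k) * deg_falling_fact lam ?y k =
        (if k = j then (a j - b j) * deg_falling_fact lam ?y j else 0)"
      using less.IH[of k] z[of k] by (cases k j rule: linorder_cases) auto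
  qed
  also have "\<dots> = (a j - b j) * deg_falling_fact lam ?y j"
    using less.prems by simp
  finally show ?case using nz by simp
qed

lemma deg_rising_eq_falling: "deg_rising_fact lam y n = deg_falling_fact (- lam) y n"
  by (simp add: deg_rising_fact_def deg_falling_fact_def)

text \<open>Recurrence for the coefficients expanding a product of linear factors
  \<open>y + c i\<close> in degenerate falling factorials.\<close>

fun conn_coeff :: "real \<Rightarrow> (nat \<Rightarrow> real) \<Rightarrow> nat \<Rightarrow> nat \<Rightarrow> real" where
  "conn_coeff lam c 0 k = (if k = 0 then 1 else 0)"
| "conn_coeff lam c (Suc n) 0 = c n * conn_coeff lam c n 0"
| "conn_coeff lam c (Suc n) (Suc k) =
     conn_coeff lam c n k + (c n + real (Suc k) * lam) * conn_coeff lam c n (Suc k)"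

lemma conn_coeff_eq_0: "k > n \<Longrightarrow> conn_coeff lam c n k = 0"
  by (induction lam c n k rule: conn_coeff.induct) auto

lemma prod_eq_sum_conn_coeff:
  "(\<Prod>i<n. y + c i) = (\<Sum>k=0..n. conn_coeff lam c n k * deg_falling_fact lam y k)"
proof (induction n)
  case 0
  then show ?case by (simp add: deg_falling_fact_def)
next
  case (Suc n)
  let ?F = "deg_falling_fact lam y" and ?C = "conn_coeff lam c n"
  have F: "?F (Suc k) = ?F k * (y - real k * lam)" for k
    by (simp add: deg_falling_fact_def)
  have "(\<Prod>i<Suc n. y + c i) = (\<Sum>k=0..n. ?C k * ?F k * (y + c n))"
    using Suc by (simp add: sum_distrib_right)
  also have "\<dots> = (\<Sum>k=0..n. ?C k * ?F (Suc k)) + (\<Sum>k=0..n. (c n + real k * lam) * ?C k * ?F k)"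
    unfolding sum.distrib[symmetric] by (intro sum.cong) (auto simp: F algebra_simps)
  also have "(\<Sum>k=0..n. (c n + real k * lam) * ?C k * ?F k) =
      (\<Sum>k=0..Suc n. (c n + real k * lam) * ?C k * ?F k)"
    by (simp add: conn_coeff_eq_0)
  also have "\<dots> = c n * ?C 0 * ?F 0 +
      (\<Sum>k=0..n. (c n + real (Suc k) * lam) * ?C (Suc k) * ?F (Suc k))"
    by (subst sum.atLeast0_atMost_Suc_shift) simp
  also have "(\<Sum>k=0..n. ?C k * ?F (Suc k)) + \<dots> =
      conn_coeff lam c (Suc n) 0 * ?F 0 + (\<Sum>k=0..n. conn_coeff lam c (Suc n) (Suc k) * ?F (Suc k))"
    by (simp add: sum.distrib[symmetric] algebra_simps)
  also have "\<dots> = (\<Sum>k=0..Suc n. conn_coeff lam c (Suc n) k * ?F k)"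
    by (simp only: sum.atLeast0_atMost_Suc_shift o_def)
  finally show ?case .
qed

lemma ex1_deg_stirling1:
  assumes "lam \<noteq> 0"
  shows "\<exists>!S. is_deg_stirling1 lam S"
proof (rule ex_ex1I)
  have "is_deg_stirling1 lam (conn_coeff lam (\<lambda>i. - real i))"
    using prod_eq_sum_conn_coeff[where c = "\<lambda>i. - real i"]
    by (simp add: is_deg_stirling1_def falling_fact_def conn_coeff_eq_0)
  then show "\<exists>S. is_deg_stirling1 lam S"
    by blast
next
  fix S T assume S: "is_deg_stirling1 lam S" and T: "is_deg_stirling1 lam T"
  have "S n k = T n k" for n k
  proof (cases "k \<le> n")
    case True
    show ?thesis
      by (rule deg_falling_fact_independent[OF assms _ True])
        (use S T in \<open>simp add: is_deg_stirling1_def\<close>)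
  next
    case False
    then show ?thesis using S T by (simp add: is_deg_stirling1_def)
  qed
  then show "S = T" by blast
qed

lemma ex1_unsigned_deg_r_stirling1:
  assumes "lam \<noteq> 0"
  shows "\<exists>!S. is_unsigned_deg_r_stirling1 r lam S"
proof (rule ex_ex1I)
  let ?C = "conn_coeff (- lam) (\<lambda>i. real r + real i)"
  have "pochhammer (y + real r) n = (\<Sum>k=0..n. ?C n k * deg_rising_fact lam y k)" for y n
    using prod_eq_sum_conn_coeff[where c = "\<lambda>i. real r + real i" and lam = "- lam" and n = n and y = y]
    by (simp add: deg_rising_eq_falling pochhammer_prod atLeast0LessThan add.assoc)
  then have "is_unsigned_deg_r_stirling1 r lam
      (\<lambda>m j. if m < r \<or> j < r then 0 else ?C (m - r) (j - r))"
    by (auto simp: is_unsigned_deg_r_stirling1_def conn_coeff_eq_0)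
  then show "\<exists>S. is_unsigned_deg_r_stirling1 r lam S"
    by blast
next
  fix S T
  assume S: "is_unsigned_deg_r_stirling1 r lam S" and T: "is_unsigned_deg_r_stirling1 r lam T"
  have shifted: "S (n + r) (k + r) = T (n + r) (k + r)" for n k
  proof (cases "k \<le> n")
    case True
    have "- lam \<noteq> 0" using assms by simp
    then show ?thesis
      by (rule deg_falling_fact_independent[OF _ _ True,
            where a = "\<lambda>k. S (n + r) (k + r)" and b = "\<lambda>k. T (n + r) (k + r)"])
        (use S T in \<open>simp add: is_unsigned_deg_r_stirling1_def deg_rising_eq_falling\<close>)
  next
    case False
    then show ?thesis using S T by (simp add: is_unsigned_deg_r_stirling1_def)
  qed
  have "S m j = T m j" for m j
  proof (cases "m < r \<or> j < r")
    case True
    then show ?thesis using S T by (auto simp: is_unsigned_deg_r_stirling1_def)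
  next
    case False
    then show ?thesis using shifted[of "m - r" "j - r"] by simp
  qed
  then show "S = T" by blast
qed

end

theory Submission
  imports Defs
begin

text \<open>
  All quantities in the theorem have closed forms in terms of the rising factorials
  \<open>\<langle>a\<rangle>\<^sub>n = pochhammer a n\<close> with \<open>a = r - j lam\<close>, and comparing these forms proves both identities.

  On the Stirling side, the rising factorials of length \<open>k\<close> with step \<open>lam\<close> vanish at \<open>y = - m lam\<close> as soon as \<open>k > m\<close>. The defining
  polynomial identity, read at \<open>y = 0, - lam, - 2 lam\<close>, is therefore a triangular linear system
  for the first three entries of a row; for the entries \<open>U\<close> it gives for example
  \<open>lam U(n+r, r+1) = \<langle>r\<rangle>\<^sub>n - \<langle>r - lam\<rangle>\<^sub>n\<close>. The same interpolation at \<open>y = 0, lam, 2 lam\<close> determines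
  column \<open>2\<close> of the numbers without \<open>r\<close>.

  On the harmonic side, the summands of the degenerate harmonic numbers are
  \<open>- \<langle>- lam\<rangle>\<^sub>k / (lam k!)\<close>, and summing \<open>\<langle>a\<rangle>\<^sub>k / k!\<close> over \<open>k \<le> n\<close> raises \<open>a\<close> by one
  (lemma \<open>sum_pochhammer_over_fact\<close>). Hence each summation step raises the order \<open>r\<close> by one in
  \<open>lam n! H\<^sub>n\<^sup>(\<^sup>r\<^sup>) = \<langle>r\<rangle>\<^sub>n - \<langle>r - lam\<rangle>\<^sub>n\<close>, which is the first identity. In the second one, both sides
  become \<open>(n! - \<langle>1 - lam\<rangle>\<^sub>n) / lam\<close>, the terms \<open>\<langle>1 - 2 lam\<rangle>\<^sub>n\<close> cancelling on the right.
\<close>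

text \<open>The hockey-stick identity with an arbitrary upper parameter: \<open>\<langle>a\<rangle>\<^sub>k / k!\<close> is the
  coefficient of \<open>x\<^sup>k\<close> in \<open>(1 - x) powr (- a)\<close>, and partial summation multiplies this formal series by
  \<open>1 / (1 - x)\<close>.\<close>

lemma sum_pochhammer_over_fact:
  fixes a :: "'a :: field_char_0"
  shows "(\<Sum>k\<le>n. pochhammer a k / fact k) = pochhammer (a + 1) n / fact n"
proof (induction n)
  case (Suc n)
  have "pochhammer a (Suc n) = a * pochhammer (a + 1) n"
    by (rule pochhammer_rec)
  then have "pochhammer (a + 1) (Suc n) = of_nat (Suc n) * pochhammer (a + 1) n + pochhammer a (Suc n)"
    by (simp add: pochhammer_Suc algebra_simps)
  then show ?case
    using Suc by (simp add: add_divide_distrib del: of_nat_Suc pochhammer_Suc)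
qed simp

lemma deg_harmonic_summand:
  fixes lam :: real
  assumes "k \<ge> 1"
  shows "1 / lam * (lam gchoose k) * (-1) ^ (k - 1) = - (pochhammer (- lam) k / fact k) / lam"
proof -
  obtain j where "k = Suc j" using assms by (cases k) auto
  moreover have "(-1) ^ j * ((-1) ^ j * x) = x" for x :: real
    by (simp only: mult.assoc[symmetric] power_add[symmetric]) simp
  ultimately show ?thesis by (simp add: gbinomial_pochhammer mult_ac del: pochhammer_Suc)
qed

text \<open>The summation over \<open>k\<close> from \<open>1\<close> to \<open>n\<close> in the definition drops the term \<open>k = 0\<close>
  of the hockey-stick identity, which is \<open>1\<close> for both parameters and cancels in the difference.\<close>

lemma sum_pochhammer_difference:
  fixes a b :: "'a :: field_char_0"
  shows "(\<Sum>k=1..n. (pochhammer a k - pochhammer b k) / fact k) =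
    (pochhammer (a + 1) n - pochhammer (b + 1) n) / fact n"
proof -
  have "(\<Sum>k=1..n. (pochhammer a k - pochhammer b k) / fact k) =
      (\<Sum>k\<le>n. (pochhammer a k - pochhammer b k) / fact k)"
    by (intro sum.mono_neutral_left) (auto simp: Suc_le_eq)
  also have "\<dots> = (pochhammer (a + 1) n - pochhammer (b + 1) n) / fact n"
    by (simp add: diff_divide_distrib sum_subtractf sum_pochhammer_over_fact)
  finally show ?thesis .
qed

text \<open>The summands of the degenerate harmonic numbers are the closed form with \<open>0\<close> in place of
  \<open>Suc r\<close>, as \<open>\<langle>0\<rangle>\<^sub>k = 0\<close> for \<open>k \<ge> 1\<close>. The base case is therefore the same summation
  step as the induction step.\<close>

lemma deg_hyperharmonic_closed_form:
  assumes "lam \<noteq> 0"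
  shows "lam * deg_hyperharmonic lam (Suc r) n =
    (pochhammer (real (Suc r)) n - pochhammer (real (Suc r) - lam) n) / fact n"
proof (induction r arbitrary: n)
  case 0
  have "lam * deg_harmonic lam n =
      (\<Sum>k=1..n. (pochhammer 0 k - pochhammer (- lam) k) / fact k)"
    unfolding deg_harmonic_def sum_distrib_left
    by (intro sum.cong refl, subst deg_harmonic_summand) (use assms in \<open>auto simp: pochhammer_0_left\<close>)
  then show ?case
    using sum_pochhammer_difference[of 0 "- lam" n] by simp
next
  case (Suc r)
  have "lam * deg_hyperharmonic lam (Suc (Suc r)) n =
      (\<Sum>k=1..n. (pochhammer (real (Suc r)) k - pochhammer (real (Suc r) - lam) k) / fact k)"
    by (simp add: sum_distrib_left Suc del: of_nat_Suc)
  also have "\<dots> = (pochhammer (real (Suc (Suc r))) n - pochhammer (real (Suc (Suc r)) - lam) n) / fact n"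
    by (subst sum_pochhammer_difference) (simp add: algebra_simps)
  finally show ?case .
qed

text \<open>Interpolation at the nodes of the degenerate factorials: at the node \<open>m lam\<close> only the
  first \<open>m + 1\<close> terms of an expansion survive.\<close>

lemma deg_falling_expansion_at_node:
  assumes "\<And>k. k > n \<Longrightarrow> a k = 0"
  shows "(\<Sum>k=0..n. a k * deg_falling_fact lam (real m * lam) k) =
         (\<Sum>k\<le>m. a k * deg_falling_fact lam (real m * lam) k)"
proof -
  have "deg_falling_fact lam (real m * lam) k = 0" if "k > m" for k
    unfolding deg_falling_fact_def using that by (intro prod_zero) auto
  then show ?thesis
    using assms by (intro sum.mono_neutral_cong) auto
qed

lemma deg_stirling1_at_node:
  assumes "lam \<noteq> 0"
  shows "falling_fact (real m * lam) n =
    (\<Sum>k\<le>m. deg_stirling1 lam n k * deg_falling_fact lam (real m * lam) k)"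
proof -
  have "is_deg_stirling1 lam (deg_stirling1 lam)"
    unfolding deg_stirling1_def by (rule theI'[OF ex1_deg_stirling1[OF assms]])
  then show ?thesis
    using deg_falling_expansion_at_node[of n "deg_stirling1 lam n" lam m]
    by (simp add: is_deg_stirling1_def)
qed

text \<open>Rising factorials with step \<open>lam\<close> are falling ones with step \<open>- lam\<close>, so the nodes are now
  the points \<open>- m lam\<close>, where \<open>\<langle>y + r\<rangle>\<^sub>n\<close> becomes \<open>\<langle>r - m lam\<rangle>\<^sub>n\<close>.\<close>

lemma unsigned_deg_r_stirling1_at_node:
  assumes "lam \<noteq> 0"
  shows "pochhammer (real r - real m * lam) n =
    (\<Sum>k\<le>m. unsigned_deg_r_stirling1 r lam (n + r) (k + r) *
             deg_falling_fact (- lam) (real m * - lam) k)"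
proof -
  let ?U = "unsigned_deg_r_stirling1 r lam"
  have U: "is_unsigned_deg_r_stirling1 r lam ?U"
    unfolding unsigned_deg_r_stirling1_def
    by (rule theI'[OF ex1_unsigned_deg_r_stirling1[OF assms]])
  then have "pochhammer (real m * - lam + real r) n =
      (\<Sum>k=0..n. ?U (n + r) (k + r) * deg_falling_fact (- lam) (real m * - lam) k)"
    unfolding is_unsigned_deg_r_stirling1_def deg_rising_eq_falling by blast
  also have "\<dots> = (\<Sum>k\<le>m. ?U (n + r) (k + r) * deg_falling_fact (- lam) (real m * - lam) k)"
    by (rule deg_falling_expansion_at_node) (use U in \<open>simp add: is_unsigned_deg_r_stirling1_def\<close>)
  finally show ?thesis by (simp add: algebra_simps)
qed

lemma unsigned_deg_r_stirling1_column_1: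
  assumes "lam \<noteq> 0"
  shows "lam * unsigned_deg_r_stirling1 r lam (n + r) (r + 1) =
    pochhammer (real r) n - pochhammer (real r - lam) n"
  using unsigned_deg_r_stirling1_at_node[OF assms, of r 0 n]
    unsigned_deg_r_stirling1_at_node[OF assms, of r 1 n]
  by (simp add: deg_falling_fact_def algebra_simps)

lemma unsigned_deg_r_stirling1_column_2:
  assumes "lam \<noteq> 0"
  shows "2 * lam\<^sup>2 * unsigned_deg_r_stirling1 r lam (n + r) (r + 2) =
    pochhammer (real r) n - 2 * pochhammer (real r - lam) n + pochhammer (real r - 2 * lam) n"
  using unsigned_deg_r_stirling1_at_node[OF assms, of r 0 n]
    unsigned_deg_r_stirling1_at_node[OF assms, of r 1 n]
    unsigned_deg_r_stirling1_at_node[OF assms, of r 2 n]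
  by (simp add: deg_falling_fact_def numeral_2_eq_2 power2_eq_square algebra_simps)

lemma falling_fact_Suc_pochhammer:
  "falling_fact y (Suc n) = (-1) ^ n * y * pochhammer (1 - y) n"
proof -
  have "(\<Prod>i<n. y - real (Suc i)) = (\<Prod>i<n. (-1) * (1 - y + real i))"
    by (intro prod.cong) auto
  also have "\<dots> = (-1) ^ n * pochhammer (1 - y) n"
    by (subst prod.distrib) (simp add: pochhammer_prod atLeast0LessThan)
  finally show ?thesis
    unfolding falling_fact_def by (subst prod.lessThan_Suc_shift) simp
qed

text \<open>Column 2 is a second difference of \<open>(y)\<^sub>n\<close> at the nodes \<open>0\<close>, \<open>lam\<close>, \<open>2 lam\<close>. Since \<open>y\<close> divides
  \<open>(y)\<^sub>n\<close>, the node \<open>0\<close> contributes nothing, and a factor \<open>lam\<close> cancels from the other two values.\<close>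

lemma unsigned_deg_stirling1_column_2:
  assumes "lam \<noteq> 0"
  shows "lam * unsigned_deg_stirling1 lam (Suc (Suc n)) 2 =
    pochhammer (1 - lam) (Suc n) - pochhammer (1 - 2 * lam) (Suc n)"
proof -
  let ?S = "deg_stirling1 lam (Suc (Suc n))"
  let ?P = "\<lambda>j. pochhammer (1 - j * lam) (Suc n)"
  have "?S 0 = 0"
    using deg_stirling1_at_node[OF assms, of 0 "Suc (Suc n)"]
    by (simp add: falling_fact_Suc_pochhammer deg_falling_fact_def)
  moreover have "(-1) ^ Suc n * lam * ?P 1 = ?S 0 + ?S 1 * lam"
    using deg_stirling1_at_node[OF assms, of 1 "Suc (Suc n)"]
    unfolding falling_fact_Suc_pochhammer by (simp add: deg_falling_fact_def)
  moreover have "(-1) ^ Suc n * (2 * lam) * ?P 2 = ?S 0 + ?S 1 * (2 * lam) + ?S 2 * (2 * lam * lam)"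
    using deg_stirling1_at_node[OF assms, of 2 "Suc (Suc n)"]
    unfolding falling_fact_Suc_pochhammer by (simp add: deg_falling_fact_def numeral_2_eq_2)
  ultimately have "2 * lam * (?S 2 * lam) = 2 * lam * ((-1) ^ n * (?P 1 - ?P 2))"
    by (simp add: algebra_simps del: pochhammer_Suc)
  then have "?S 2 * lam = (-1) ^ n * (?P 1 - ?P 2)"
    using assms by (simp only: mult_cancel_left) simp
  then have "(-1) ^ n * (?S 2 * lam) = ?P 1 - ?P 2"
    by (simp only: mult.assoc[symmetric] power_add[symmetric]) simp
  then show ?thesis
    by (simp add: unsigned_deg_stirling1_def mult_ac)
qed

theorem theorem5:
  fixes lam :: real
  assumes "lam \<noteq> 0"
  shows "(\<forall>n r :: nat. n \<ge> 1 \<longrightarrow> r \<ge> 1 \<longrightarrow>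
            fact n * deg_hyperharmonic lam r n = unsigned_deg_r_stirling1 r lam (n + r) (r + 1)) \<and>
         (\<forall>n :: nat. n \<ge> 1 \<longrightarrow>
            fact n * deg_harmonic lam n =
              fact 2 * lam * unsigned_deg_r_stirling1 1 lam (n + 1) 3 +
              unsigned_deg_stirling1 lam (n + 1) 2)"
proof (intro conjI allI impI)
  fix n r :: nat
  assume "n \<ge> 1" "r \<ge> 1"
  then obtain s where r: "r = Suc s" by (cases r) auto
  have "lam * (fact n * deg_hyperharmonic lam r n) =
      lam * unsigned_deg_r_stirling1 r lam (n + r) (r + 1)"
    using deg_hyperharmonic_closed_form[OF assms, of s n]
      unsigned_deg_r_stirling1_column_1[OF assms, of r n]
    by (simp only: r) (simp add: nonzero_eq_divide_eq mult_ac)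
  then show "fact n * deg_hyperharmonic lam r n = unsigned_deg_r_stirling1 r lam (n + r) (r + 1)"
    using assms by simp
next
  fix n :: nat
  assume "n \<ge> 1"
  then obtain k where n: "n = Suc k" by (cases n) auto
  let ?U = "unsigned_deg_r_stirling1 1 lam (n + 1) 3"
  let ?V = "unsigned_deg_stirling1 lam (n + 1) 2"
  let ?P = "\<lambda>j. pochhammer (1 - j * lam) n"
  have H: "lam * (fact n * deg_harmonic lam n) = fact n - ?P 1"
    using deg_hyperharmonic_closed_form[OF assms, of 0 n]
    by (simp add: field_simps pochhammer_fact[symmetric])
  have U: "2 * lam\<^sup>2 * ?U = fact n - 2 * ?P 1 + ?P 2"
    using unsigned_deg_r_stirling1_column_2[OF assms, of 1 n]
    by (simp add: pochhammer_fact[symmetric] numeral_3_eq_3 numeral_2_eq_2)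
  have V: "lam * ?V = ?P 1 - ?P 2"
    using unsigned_deg_stirling1_column_2[OF assms, of k] by (simp add: n del: pochhammer_Suc)
  have "lam * (fact n * deg_harmonic lam n) = lam * (fact 2 * lam * ?U + ?V)"
    using H U V by (simp add: algebra_simps power2_eq_square)
  then show "fact n * deg_harmonic lam n = fact 2 * lam * ?U + ?V"
    using assms by simp
qed

end
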